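(* Let $G$ be a connected graph with non-sink vertex set $V$, let $B\subseteq V$ be a finite set such that removing $B$ and all edges incident to $B$ disconnects $G$ into two graphs, at least one of which is finite; let $F$ be this finite graph, and let $S$ be the graph formed by $F$ together with the vertices of $B$ as sinks, including the edges between $F$ and $B$. Let $\eta_F$ and $\eta_G$ be configurations on $F$ and on $G$ respectively, with $\eta_F$ extended by $0$ to $G\setminus F$. Suppose that for every $k\ge N(F,\eta_F)$ it is possible to stabilize the configuration $k\eta_F+\eta_G$ on $G$, and that this stabilization causes each vertex of $B$ to topple the same number of times. For $v\in F$ let $f_v(k)=(k\eta_F+\eta_G)^{\circ}(v)$, the stabilization being taken on $G$. Then for each $v\in F$ the function $k\mapsto f_v(k)$ is eventually periodic.
   Context: A configuration on a graph is a function $\eta$ from its non-sink vertices to $\{0,1,2,\dots\}$ (numbers of chips). A non-sink vertex $v$ with $\eta(v)\ge\deg(v)$ is unstable and may topple, sending one chip along each incident edge; chips reaching a sink are removed and sinks never topple. A configuration is stable if no non-sink vertex is unstable. If toppling unstable vertices reaches a stable configuration after finitely many topplings (stabilization is possible), that configuration, denoted $\eta^\circ$, and the number of times each vertex topples (the odometer) are independent of the order of topplings. In a graph with several sinks, the set of sinks may be collapsed to one sink. The graph $G$ may be infinite; if $G$ has a sink, it does not belong to $F$. In $G$ the vertices of $B$ are ordinary vertices (they topple); in $S$ they are sinks. A configuration $\sigma$ on a finite graph with sink(s) is recurrent if it is stable and for every configuration $\eta$ there is a configuration $\eta'$ with $\sigma=(\eta+\eta')^\circ$. $N(F,\eta_F)$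 denotes an integer such that for all $k\ge N(F,\eta_F)$ the stabilization of $k\eta_F$ on $S$ is recurrent (such an integer exists for nonzero $\eta_F$). *)

theory Defs
  imports Main
begin

text \<open>
  A graph is undirected, loopless and possibly infinite; \<open>mult G u v\<close> is the number of edges
  between \<open>u\<close> and \<open>v\<close>.  Parallel edges are allowed, since collapsing several sinks to one
  produces them.  Vertices that are not sinks have finite degree.
\<close>

record 'a sink_graph =
  verts :: "'a set"
  sinks :: "'a set"
  mult :: "'a \<Rightarrow> 'a \<Rightarrow> nat"

definition nonsinks :: "'a sink_graph \<Rightarrow> 'a set" where
  "nonsinks G = verts G - sinks G"

locale wf_sink_graph =
  fixes G :: "'a sink_graph"
  assumes sinks_subset: "sinks G \<subseteq> verts G"
    and mult_verts: "mult G u v > 0 \<Longrightarrow> u \<in> verts G \<and> v \<in> verts G"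
    and mult_sym: "mult G u v = mult G v u"
    and mult_loopless: "mult G v v = 0"
    and locally_finite: "v \<in> nonsinks G \<Longrightarrow> finite {u. mult G v u > 0}"

definition deg :: "'a sink_graph \<Rightarrow> 'a \<Rightarrow> nat" where
  "deg G v = (\<Sum>u | mult G v u > 0. mult G v u)"

definition connected_graph :: "'a sink_graph \<Rightarrow> bool" where
  "connected_graph G \<longleftrightarrow>
     verts G \<noteq> {} \<and> (\<forall>u\<in>verts G. \<forall>v\<in>verts G. (\<lambda>x y. mult G x y > 0)\<^sup>*\<^sup>* u v)"

text \<open>
  The vertex sets \<open>F\<close> and \<open>H\<close> are the two parts left of \<open>G\<close> after removing \<open>B\<close>.  Neither part
  is required to be connected.
\<close>

definition disconnects_into :: "'a sink_graph \<Rightarrow> 'a set \<Rightarrow> 'a set \<Rightarrow> 'a set \<Rightarrow> bool" where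
  "disconnects_into G B F H \<longleftrightarrow>
     F \<noteq> {} \<and> H \<noteq> {} \<and> F \<inter> H = {} \<and> F \<union> H = verts G - B \<and>
     (\<forall>u\<in>F. \<forall>w\<in>H. mult G u w = 0)"

text \<open>Edges between two vertices of \<open>B\<close> are dropped.\<close>

definition with_sink_boundary :: "'a sink_graph \<Rightarrow> 'a set \<Rightarrow> 'a set \<Rightarrow> 'a sink_graph" where
  "with_sink_boundary G F B =
     \<lparr>verts = F \<union> B, sinks = B,
      mult = (\<lambda>u v. if u \<in> F \<and> v \<in> F \<union> B \<or> u \<in> B \<and> v \<in> F then mult G u v else 0)\<rparr>"

text \<open>
  Configurations are total functions that vanish off the non-sink vertices, so that equality of
  functions is equality of configurations, and a configuration on a part of a graph is at the
  same time its extension by zero.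
\<close>

definition configuration :: "'a sink_graph \<Rightarrow> ('a \<Rightarrow> nat) \<Rightarrow> bool" where
  "configuration G \<eta> \<longleftrightarrow> (\<forall>v. v \<notin> nonsinks G \<longrightarrow> \<eta> v = 0)"

definition unstable :: "'a sink_graph \<Rightarrow> ('a \<Rightarrow> nat) \<Rightarrow> 'a \<Rightarrow> bool" where
  "unstable G \<eta> v \<longleftrightarrow> v \<in> nonsinks G \<and> \<eta> v \<ge> deg G v"

definition stable :: "'a sink_graph \<Rightarrow> ('a \<Rightarrow> nat) \<Rightarrow> bool" where
  "stable G \<eta> \<longleftrightarrow> (\<forall>v. \<not> unstable G \<eta> v)"

text \<open>Only unstable vertices are ever toppled, so the subtraction does not truncate.\<close>

definition topple :: "'a sink_graph \<Rightarrow> 'a \<Rightarrow> ('a \<Rightarrow> nat) \<Rightarrow> 'a \<Rightarrow> nat" where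
  "topple G v \<eta> =
     (\<lambda>u. if u \<in> nonsinks G then (if u = v then \<eta> u - deg G v else \<eta> u) + mult G v u else \<eta> u)"

inductive topples_to ::
  "'a sink_graph \<Rightarrow> ('a \<Rightarrow> nat) \<Rightarrow> 'a list \<Rightarrow> ('a \<Rightarrow> nat) \<Rightarrow> bool" for G where
  Nil: "topples_to G \<eta> [] \<eta>"
| Cons: "unstable G \<eta> v \<Longrightarrow> topples_to G (topple G v \<eta>) vs \<eta>' \<Longrightarrow> topples_to G \<eta> (v # vs) \<eta>'"

definition stabilizes_via ::
  "'a sink_graph \<Rightarrow> ('a \<Rightarrow> nat) \<Rightarrow> 'a list \<Rightarrow> ('a \<Rightarrow> nat) \<Rightarrow> bool" where
  "stabilizes_via G \<eta> vs \<eta>' \<longleftrightarrow> topples_to G \<eta> vs \<eta>' \<and> stable G \<eta>'"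

definition stabilizable :: "'a sink_graph \<Rightarrow> ('a \<Rightarrow> nat) \<Rightarrow> bool" where
  "stabilizable G \<eta> \<longleftrightarrow> (\<exists>vs \<eta>'. stabilizes_via G \<eta> vs \<eta>')"

text \<open>
  The following two are meaningful for stabilizable configurations, where the final
  configuration and the toppling counts do not depend on the order of topplings.
\<close>

definition stabilization :: "'a sink_graph \<Rightarrow> ('a \<Rightarrow> nat) \<Rightarrow> 'a \<Rightarrow> nat" where
  "stabilization G \<eta> = (THE \<eta>'. \<exists>vs. stabilizes_via G \<eta> vs \<eta>')"

definition odometer :: "'a sink_graph \<Rightarrow> ('a \<Rightarrow> nat) \<Rightarrow> 'a \<Rightarrow> nat" where
  "odometer G \<eta> = (THE u. \<exists>vs \<eta>'. stabilizes_via G \<eta> vs \<eta>' \<and> u = count_list vs)"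

definition recurrent :: "'a sink_graph \<Rightarrow> ('a \<Rightarrow> nat) \<Rightarrow> bool" where
  "recurrent G \<sigma> \<longleftrightarrow>
     configuration G \<sigma> \<and> stable G \<sigma> \<and>
     (\<forall>\<eta>. configuration G \<eta> \<longrightarrow>
        (\<exists>\<eta>'. configuration G \<eta>' \<and> stabilizable G (\<lambda>v. \<eta> v + \<eta>' v) \<and>
              \<sigma> = stabilization G (\<lambda>v. \<eta> v + \<eta>' v)))"

definition eventually_periodic :: "(nat \<Rightarrow> 'b) \<Rightarrow> bool" where
  "eventually_periodic f \<longleftrightarrow> (\<exists>p>0. \<exists>k\<^sub>0. \<forall>k\<ge>k\<^sub>0. f (k + p) = f k)"

end

theory Submission
  imports Defs
begin

text \<open>
  Let \<open>\<beta>\<close> be the configuration on \<open>S\<close> obtained by letting every vertex of \<open>B\<close> send out its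
  chips once, and let \<open>r\<^sub>k\<close> be the stabilization of \<open>k\<eta>\<^sub>F\<close> on \<open>S\<close>.  Adding \<open>\<beta>\<close> to a recurrent
  configuration and stabilizing gives the same configuration back.  If every vertex of \<open>B\<close>
  topples \<open>t\<close> times in \<open>G\<close>, the restriction of the stabilization to \<open>F\<close> is the stabilization on
  \<open>S\<close> of \<open>k\<eta>\<^sub>F + \<eta>\<^sub>G + t\<beta>\<close>, hence that of \<open>r\<^sub>k + t\<beta> + \<eta>\<^sub>G\<close>, hence that of \<open>r\<^sub>k + \<eta>\<^sub>G\<close>.
  Finally \<open>r\<^sub>k\<^sub>+\<^sub>1\<close> is the stabilization of \<open>r\<^sub>k + \<eta>\<^sub>F\<close>, so the sequence \<open>r\<^sub>k\<close> is an orbit of a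
  map on a finite set.
\<close>

section \<open>Legal toppling sequences\<close>

lemma unstable_topple:
  assumes "unstable G \<eta> v" "v \<noteq> w"
  shows "unstable G (topple G w \<eta>) v"
  using assms by (auto simp: unstable_def topple_def)

lemma topple_commute:
  assumes "unstable G \<eta> v" "unstable G \<eta> w" "v \<noteq> w"
  shows "topple G v (topple G w \<eta>) = topple G w (topple G v \<eta>)"
  using assms by (auto simp: unstable_def topple_def fun_eq_iff)

lemma topple_add:
  assumes "unstable G \<eta> v"
  shows "topple G v (\<lambda>u. \<eta> u + \<xi> u) = (\<lambda>u. topple G v \<eta> u + \<xi> u)"
  using assms by (auto simp: unstable_def topple_def fun_eq_iff)

lemma unstable_add: "unstable G \<eta> v \<Longrightarrow> unstable G (\<lambda>u. \<eta> u + \<xi> u) v"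
  by (auto simp: unstable_def)

lemma topples_to_add:
  "topples_to G \<eta> vs \<eta>' \<Longrightarrow> topples_to G (\<lambda>u. \<eta> u + \<xi> u) vs (\<lambda>u. \<eta>' u + \<xi> u)"
  by (induction rule: topples_to.induct)
    (auto intro: topples_to.intros simp: unstable_add topple_add)

lemma topples_to_append:
  "topples_to G \<eta> vs \<eta>' \<Longrightarrow> topples_to G \<eta>' ws \<eta>'' \<Longrightarrow> topples_to G \<eta> (vs @ ws) \<eta>''"
  by (induction rule: topples_to.induct) (auto intro: topples_to.intros)

text \<open>Conservation of chips at \<open>u\<close>. The chips lost stand on the left, so that no
  truncated subtraction occurs.\<close>

lemma topples_to_chips:
  assumes "topples_to G \<eta> vs \<eta>'" "u \<in> nonsinks G"
  shows "\<eta>' u + deg G u * count_list vs u = \<eta> u + (\<Sum>w\<leftarrow>vs. mult G w u)"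
  using assms
proof (induction rule: topples_to.induct)
  case (Cons \<eta> v vs \<eta>')
  then show ?case
    by (cases "u = v") (auto simp: topple_def unstable_def)
qed simp

lemma topples_to_sink:
  "topples_to G \<eta> vs \<eta>' \<Longrightarrow> u \<notin> nonsinks G \<Longrightarrow> \<eta>' u = \<eta> u"
  by (induction rule: topples_to.induct) (auto simp: topple_def)

section \<open>Independence of the order of topplings\<close>

text \<open>Topplings elsewhere only add chips at \<open>v\<close>, so \<open>v\<close> stays
  unstable until it topples and must occur in \<open>ws\<close>. Its first occurrence, the one
  deleted by \<open>remove1\<close>, commutes past everything before it to the front.\<close>

lemma stabilizes_via_topple:
  assumes "topples_to G \<eta> ws \<tau>" "stable G \<tau>" "unstable G \<eta> v"
  shows "v \<in> set ws \<and> topples_to G (topple G v \<eta>) (remove1 v ws) \<tau>"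
  using assms
proof (induction rule: topples_to.induct)
  case (Nil \<eta>)
  then show ?case by (auto simp: stable_def)
next
  case (Cons \<eta> w ws \<tau>)
  show ?case
  proof (cases "w = v")
    case True
    then show ?thesis using Cons by simp
  next
    case False
    then have "v \<in> set ws \<and> topples_to G (topple G v (topple G w \<eta>)) (remove1 v ws) \<tau>"
      using Cons unstable_topple by metis
    moreover have "topple G v (topple G w \<eta>) = topple G w (topple G v \<eta>)"
      using Cons False topple_commute by metis
    moreover have "unstable G (topple G v \<eta>) w"
      using Cons False unstable_topple by metis
    ultimately show ?thesis using False by (auto intro: topples_to.intros)
  qed
qed

lemma count_list_remove1:
  "v \<in> set ws \<Longrightarrow> count_list ws x = (if x = v then 1 else 0) + count_list (remove1 v ws) x"
  by (induction ws) auto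

text \<open>The entries of \<open>vs\<close> are moved to the front of \<open>ws\<close> and
  cancelled one after another. Keeping the counts yields the uniqueness of the odometer as well as
  of the final configuration.\<close>

lemma stabilizes_via_continue:
  assumes "topples_to G \<eta> vs \<eta>'" "stabilizes_via G \<eta> ws \<tau>"
  shows "\<exists>ws'. stabilizes_via G \<eta>' ws' \<tau> \<and>
           (\<forall>x. count_list ws x = count_list vs x + count_list ws' x)"
  using assms
proof (induction arbitrary: ws rule: topples_to.induct)
  case (Nil \<eta>)
  then show ?case by auto
next
  case (Cons \<eta> v vs \<eta>')
  then have v: "v \<in> set ws" "stabilizes_via G (topple G v \<eta>) (remove1 v ws) \<tau>"
    using stabilizes_via_topple[of G \<eta> ws \<tau> v] by (auto simp: stabilizes_via_def)
  from Cons.IH[OF v(2)] obtain ws' where ws': "stabilizes_via G \<eta>' ws' \<tau>"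
    "\<And>x. count_list (remove1 v ws) x = count_list vs x + count_list ws' x" by auto
  have "count_list ws x = count_list (v # vs) x + count_list ws' x" for x
    using count_list_remove1[OF v(1), of x] ws'(2)[of x] by auto
  then show ?case using ws'(1) by blast
qed

lemma stable_stabilizes_via:
  assumes "stable G \<eta>" "stabilizes_via G \<eta> vs \<tau>"
  shows "vs = []" "\<tau> = \<eta>"
proof -
  have "topples_to G \<eta> vs \<tau>" using assms(2) by (simp add: stabilizes_via_def)
  then have "vs = [] \<and> \<tau> = \<eta>"
    by cases (use assms(1) in \<open>auto simp: stable_def\<close>)
  then show "vs = []" "\<tau> = \<eta>" by auto
qed

lemma stabilizes_via_unique:
  assumes "stabilizes_via G \<eta> vs \<sigma>" "stabilizes_via G \<eta> ws \<tau>"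
  shows "\<sigma> = \<tau>" "count_list vs = count_list ws"
proof -
  obtain ws' where ws': "stabilizes_via G \<sigma> ws' \<tau>"
    "\<And>x. count_list ws x = count_list vs x + count_list ws' x"
    using stabilizes_via_continue[of G \<eta> vs \<sigma> ws \<tau>] assms by (auto simp: stabilizes_via_def)
  have "stable G \<sigma>" using assms(1) by (simp add: stabilizes_via_def)
  from stable_stabilizes_via[OF this ws'(1)] ws'(2)
  show "\<sigma> = \<tau>" "count_list vs = count_list ws" by auto
qed

lemma stabilization_eqI: "stabilizes_via G \<eta> vs \<tau> \<Longrightarrow> stabilization G \<eta> = \<tau>"
  unfolding stabilization_def by (rule the_equality) (auto dest: stabilizes_via_unique(1))

lemma odometer_eqI: "stabilizes_via G \<eta> vs \<tau> \<Longrightarrow> odometer G \<eta> = count_list vs"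
  unfolding odometer_def by (rule the_equality) (auto dest: stabilizes_via_unique(2))

lemma stabilizes_via_stabilization:
  "stabilizable G \<eta> \<Longrightarrow> \<exists>vs. stabilizes_via G \<eta> vs (stabilization G \<eta>)"
  unfolding stabilizable_def using stabilization_eqI by metis

lemma stabilization_topples_to:
  assumes "topples_to G \<eta> vs \<eta>'" "stabilizable G \<eta>"
  shows "stabilizable G \<eta>'" "stabilization G \<eta> = stabilization G \<eta>'"
proof -
  obtain ws where "stabilizes_via G \<eta> ws (stabilization G \<eta>)"
    using stabilizes_via_stabilization[OF assms(2)] by blast
  then obtain ws' where "stabilizes_via G \<eta>' ws' (stabilization G \<eta>)"
    using stabilizes_via_continue[OF assms(1)] by blast
  then show "stabilizable G \<eta>'" "stabilization G \<eta> = stabilization G \<eta>'"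
    by (auto simp: stabilizable_def dest: stabilization_eqI)
qed

lemma stabilizable_topples_to:
  "topples_to G \<eta> vs \<eta>' \<Longrightarrow> stabilizable G \<eta>' \<Longrightarrow> stabilizable G \<eta>"
  unfolding stabilizable_def stabilizes_via_def using topples_to_append by blast

section \<open>Stabilizing in stages\<close>

text \<open>Every toppling legal for \<eta> is legal for \<eta> + \<xi> and uses up one entry of a
  sequence stabilizing the latter, so toppling from \<eta> stops after at most that many
  steps.\<close>

lemma stabilizable_mono:
  assumes "stabilizable G (\<lambda>u. \<eta> u + \<xi> u)"
  shows "stabilizable G \<eta>"
proof -
  have "stabilizable G \<eta>" if "stabilizes_via G (\<lambda>u. \<eta> u + \<xi> u) ws \<tau>" for ws \<tau>
    using that
  proof (induction "length ws" arbitrary: \<eta> ws rule: less_induct)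
    case less
    show ?case
    proof (cases "stable G \<eta>")
      case True
      then show ?thesis
        by (auto simp: stabilizable_def stabilizes_via_def intro: topples_to.intros)
    next
      case False
      then obtain v where v: "unstable G \<eta> v" by (auto simp: stable_def)
      then have ws: "v \<in> set ws"
        "stabilizes_via G (\<lambda>u. topple G v \<eta> u + \<xi> u) (remove1 v ws) \<tau>"
        using stabilizes_via_topple[of G "\<lambda>u. \<eta> u + \<xi> u" ws \<tau> v] less.prems
          unstable_add[of G \<eta> v \<xi>]
        by (auto simp: stabilizes_via_def topple_add)
      moreover have "length (remove1 v ws) < length ws"
        using ws(1) by (metis One_nat_def diff_less length_pos_if_in_set length_remove1 zero_less_one)
      ultimately have "stabilizable G (topple G v \<eta>)" using less.hyps by blast
      then show ?thesis
        using v by (auto simp: stabilizable_def stabilizes_via_def intro: topples_to.intros)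
    qed
  qed
  then show ?thesis using assms by (auto simp: stabilizable_def)
qed

text \<open>The topplings that stabilize \<eta> remain legal in the presence of \<xi>, and the order
  does not matter.\<close>

lemma stabilization_add:
  assumes "stabilizable G (\<lambda>u. \<eta> u + \<xi> u)"
  shows "stabilizable G (\<lambda>u. stabilization G \<eta> u + \<xi> u)"
    and "stabilization G (\<lambda>u. \<eta> u + \<xi> u) = stabilization G (\<lambda>u. stabilization G \<eta> u + \<xi> u)"
proof -
  obtain vs where "topples_to G \<eta> vs (stabilization G \<eta>)"
    using stabilizes_via_stabilization[OF stabilizable_mono[OF assms]]
    by (auto simp: stabilizes_via_def)
  note stabilization_topples_to[OF topples_to_add[OF this] assms]
  then show "stabilizable G (\<lambda>u. stabilization G \<eta> u + \<xi> u)"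
    and "stabilization G (\<lambda>u. \<eta> u + \<xi> u) = stabilization G (\<lambda>u. stabilization G \<eta> u + \<xi> u)"
    by auto
qed

section \<open>The burning configuration\<close>

lemma count_list_distinct: "distinct xs \<Longrightarrow> x \<in> set xs \<Longrightarrow> count_list xs x = 1"
  by (induction xs) (auto simp: count_list_0_iff)

lemma topples_to_distinct:
  assumes "distinct xs" "\<And>v. v \<in> set xs \<Longrightarrow> unstable G \<eta> v"
  shows "\<exists>\<eta>'. topples_to G \<eta> xs \<eta>'"
  using assms
proof (induction xs arbitrary: \<eta>)
  case Nil
  then show ?case by (auto intro: topples_to.intros)
next
  case (Cons x xs)
  have "unstable G (topple G x \<eta>) v" if "v \<in> set xs" for v
    using Cons.prems that by (auto intro: unstable_topple)
  then obtain \<eta>' where "topples_to G (topple G x \<eta>) xs \<eta>'"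
    using Cons.IH[of "topple G x \<eta>"] Cons.prems(1) by (meson distinct.simps(2))
  then show ?case using Cons.prems by (auto intro: topples_to.intros)
qed

text \<open>This is the \<beta> of the overview, for an arbitrary graph with sinks. Summing over the
  neighbouring sinks only keeps the index set finite at a non-sink vertex even if there are
  infinitely many sinks.\<close>

definition burning :: "'a sink_graph \<Rightarrow> 'a \<Rightarrow> nat" where
  "burning G v = (if v \<in> nonsinks G then \<Sum>s | s \<in> sinks G \<and> mult G s v > 0. mult G s v else 0)"

text \<open>The neighbours of \<open>v\<close> split into sinks and non-sinks. Hence adding \<beta>
  and toppling each non-sink vertex once changes nothing in total.\<close>

lemma (in wf_sink_graph) deg_eq_burning:
  assumes "finite (nonsinks G)" "v \<in> nonsinks G"
  shows "deg G v = burning G v + (\<Sum>w\<in>nonsinks G. mult G w v)"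
proof -
  let ?A = "{s. s \<in> sinks G \<and> mult G s v > 0}" and ?C = "{w \<in> nonsinks G. mult G w v > 0}"
  have fin: "finite {u. mult G v u > 0}"
    using assms(2) by (rule locally_finite)
  have nb: "{u. mult G v u > 0} = ?A \<union> ?C"
    using mult_verts mult_sym by (auto simp: nonsinks_def)
  have disj: "?A \<inter> ?C = {}" by (auto simp: nonsinks_def)
  have "deg G v = (\<Sum>u\<in>?A \<union> ?C. mult G u v)"
    unfolding deg_def nb by (simp add: mult_sym)
  also have "\<dots> = (\<Sum>u\<in>?A. mult G u v) + (\<Sum>u\<in>?C. mult G u v)"
    using fin disj unfolding nb by (intro sum.union_disjoint) auto
  also have "(\<Sum>u\<in>?C. mult G u v) = (\<Sum>u\<in>nonsinks G. mult G u v)"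
    using assms(1) by (intro sum.mono_neutral_left) auto
  finally show ?thesis using assms(2) by (simp add: burning_def)
qed

text \<open>
  A recurrent configuration is the stabilization of some \<open>c \<ge> deg\<close>.  From \<open>c + \<beta>\<close> every vertex
  can be toppled exactly once, which leads back to \<open>c\<close>.
\<close>

lemma (in wf_sink_graph) topples_to_burning:
  assumes fin: "finite (nonsinks G)" and rec: "recurrent G \<sigma>"
  shows "\<exists>vs. topples_to G (\<lambda>v. \<sigma> v + burning G v) vs \<sigma>"
proof -
  define \<delta> where "\<delta> v = (if v \<in> nonsinks G then deg G v else 0)" for v
  have "configuration G \<delta>" by (auto simp: configuration_def \<delta>_def)
  then obtain \<eta>' where \<eta>': "stabilizable G (\<lambda>v. \<delta> v + \<eta>' v)"
    "\<sigma> = stabilization G (\<lambda>v. \<delta> v + \<eta>' v)"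
    using rec unfolding recurrent_def by blast
  define c where "c v = \<delta> v + \<eta>' v" for v
  have c: "stabilizable G c" "\<sigma> = stabilization G c"
    using \<eta>' unfolding c_def by auto
  obtain xs where xs: "distinct xs" "set xs = nonsinks G"
    using finite_distinct_list[OF fin] by blast
  have "unstable G (\<lambda>v. c v + burning G v) v" if "v \<in> set xs" for v
    using that xs(2) by (auto simp: unstable_def c_def \<delta>_def)
  then obtain c' where c': "topples_to G (\<lambda>v. c v + burning G v) xs c'"
    using topples_to_distinct[OF xs(1)] by blast
  have "c' u = c u" for u
  proof (cases "u \<in> nonsinks G")
    case True
    have "c' u + deg G u * count_list xs u
        = c u + burning G u + (\<Sum>w\<leftarrow>xs. mult G w u)"
      using topples_to_chips[OF c' True] .
    moreover have "count_list xs u = 1"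
      using xs True by (simp add: count_list_distinct)
    moreover have "(\<Sum>w\<leftarrow>xs. mult G w u) = (\<Sum>w\<in>nonsinks G. mult G w u)"
      using xs by (metis sum_list_distinct_conv_sum_set)
    ultimately show ?thesis using deg_eq_burning[OF fin True] by simp
  next
    case False
    then show ?thesis using topples_to_sink[OF c' False] by (simp add: burning_def)
  qed
  then have "c' = c" by auto
  with c' have top: "topples_to G (\<lambda>v. c v + burning G v) xs c" by simp
  then have st: "stabilizable G (\<lambda>v. c v + burning G v)"
    using c(1) stabilizable_topples_to by blast
  \<comment> \<open>Stabilizing \<open>c\<close> inside \<open>c\<close> + \<beta> leaves \<sigma> +
    \<beta>, whereas toppling every vertex once leads back to \<open>c\<close> and then to \<sigma>.
    By order independence the results agree.\<close>
  have "stabilization G (\<lambda>v. \<sigma> v + burning G v) = \<sigma>"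
    unfolding c(2) stabilization_add(2)[OF st, symmetric]
    by (rule stabilization_topples_to(2)[OF top st])
  moreover have "stabilizable G (\<lambda>v. \<sigma> v + burning G v)"
    unfolding c(2) by (rule stabilization_add(1)[OF st])
  ultimately show ?thesis
    using stabilizes_via_stabilization unfolding stabilizes_via_def by metis
qed

lemma (in wf_sink_graph) topples_to_burning_multiple:
  assumes "finite (nonsinks G)" "recurrent G \<sigma>"
  shows "\<exists>vs. topples_to G (\<lambda>v. \<sigma> v + t * burning G v) vs \<sigma>"
proof (induction t)
  case 0
  have "topples_to G \<sigma> [] \<sigma>" by (rule topples_to.intros)
  then show ?case by auto
next
  case (Suc t)
  obtain vs where "topples_to G (\<lambda>v. \<sigma> v + burning G v) vs \<sigma>"
    using topples_to_burning[OF assms] by blast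
  \<comment> \<open>One copy of \<beta> is absorbed while the other \<open>t\<close> copies are
    carried along as spectators.\<close>
  from topples_to_add[OF this, of "\<lambda>v. t * burning G v"]
  have "topples_to G (\<lambda>v. \<sigma> v + Suc t * burning G v) vs (\<lambda>v. \<sigma> v + t * burning G v)"
    by (simp add: add.assoc)
  then show ?case using Suc topples_to_append by blast
qed

section \<open>Orbits in a finite set of configurations\<close>

text \<open>By the pigeonhole principle two values coincide, and iterating \<open>g\<close>
  propagates the coincidence. The bound \<open>k\<^sub>0 \<ge> N\<close> keeps the periodic range
  inside the range where recurrence is known.\<close>

lemma eventually_periodic_finite_orbit:
  assumes "finite A" "\<And>k. k \<ge> N \<Longrightarrow> r k \<in> A" "\<And>k. k \<ge> N \<Longrightarrow> r (Suc k) = g (r k)"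
  shows "\<exists>p>0. \<exists>k\<^sub>0\<ge>N. \<forall>k\<ge>k\<^sub>0. r (k + p) = r k"
proof -
  have "finite (r ` {N..})" by (rule finite_subset[OF _ assms(1)]) (use assms(2) in auto)
  then have "\<not> inj_on r {N..}" using finite_imageD infinite_Ici by blast
  then obtain i j where ij: "N \<le> i" "i < j" "r i = r j"
    unfolding inj_on_def by (metis atLeast_iff linorder_neqE_nat)
  have "r (i + n + (j - i)) = r (i + n)" for n
  proof (induction n)
    case (Suc n)
    then show ?case using assms(3)[of "i + n"] assms(3)[of "i + n + (j - i)"] ij(1) by simp
  qed (use ij in simp)
  then have "\<forall>k\<ge>i. r (k + (j - i)) = r k" by (metis le_Suc_ex)
  then show ?thesis using ij by (intro exI[of _ "j - i"]) auto
qed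

lemma finite_stable_configurations:
  assumes "finite (nonsinks G)"
  shows "finite {\<sigma>. configuration G \<sigma> \<and> stable G \<sigma>}"
proof -
  \<comment> \<open>A single finite codomain for all vertices, as
    \<open>finite_set_of_finite_funs\<close> requires.\<close>
  let ?D = "\<Union>v\<in>nonsinks G. {..<deg G v}"
  have "{\<sigma>. configuration G \<sigma> \<and> stable G \<sigma>}
    \<subseteq> {\<sigma>. \<forall>v. (v \<in> nonsinks G \<longrightarrow> \<sigma> v \<in> ?D) \<and> (v \<notin> nonsinks G \<longrightarrow> \<sigma> v = 0)}"
    by (auto simp: configuration_def stable_def unstable_def not_le)
  moreover have "finite \<dots>" using assms by (intro finite_set_of_finite_funs) auto
  ultimately show ?thesis by (rule finite_subset)
qed

section \<open>Comparison of topplings on G and on S\<close>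

locale separated_part = wf_sink_graph G for G :: "'a sink_graph" +
  fixes B F H :: "'a set"
  assumes finite_B: "finite B" and B_nonsinks: "B \<subseteq> nonsinks G"
    and disconnects: "disconnects_into G B F H"
    and finite_F: "finite F" and F_sinks: "F \<inter> sinks G = {}"
begin

abbreviation S where "S \<equiv> with_sink_boundary G F B"

definition restr :: "('a \<Rightarrow> nat) \<Rightarrow> 'a \<Rightarrow> nat" where
  "restr \<eta> v = (if v \<in> F then \<eta> v else 0)"

lemma FB: "F \<inter> B = {}" and F_nonsinks: "F \<subseteq> nonsinks G"
  using disconnects F_sinks by (auto simp: disconnects_into_def nonsinks_def)

lemma nonsinks_S: "nonsinks S = F"
  using FB by (auto simp: nonsinks_def with_sink_boundary_def)

lemma mult_F: "v \<in> F \<Longrightarrow> mult G v u > 0 \<Longrightarrow> u \<in> F \<union> B"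
  using disconnects mult_verts[of v u] by (auto simp: disconnects_into_def)

lemma mult_S: "v \<in> F \<Longrightarrow> mult S v u = mult G v u"
  using mult_F[of v u] by (auto simp: with_sink_boundary_def)

lemma deg_S: "v \<in> F \<Longrightarrow> deg S v = deg G v"
  by (simp add: deg_def mult_S)

lemma wf_S: "wf_sink_graph S"
proof
  fix v assume "v \<in> nonsinks S"
  then show "finite {u. 0 < mult S v u}"
    using F_nonsinks locally_finite by (auto simp: nonsinks_S mult_S)
qed (auto simp: with_sink_boundary_def mult_loopless mult_sym split: if_splits)

lemma burning_S: "v \<in> F \<Longrightarrow> burning S v = (\<Sum>b\<in>B. mult G b v)"
  unfolding burning_def nonsinks_S
  by (simp add: with_sink_boundary_def) (rule sum.mono_neutral_cong_left, use FB finite_B in auto)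

lemma restr_topple_F:
  assumes "unstable G \<eta> v" "v \<in> F"
  shows "unstable S (restr \<eta>) v" "restr (topple G v \<eta>) = topple S v (restr \<eta>)"
  using assms F_nonsinks
  by (auto simp: unstable_def restr_def topple_def nonsinks_S deg_S mult_S fun_eq_iff)

text \<open>Outside F only vertices of B have neighbours in F, so topplings elsewhere are invisible
  on F.\<close>

lemma restr_topple_not_F:
  assumes "unstable G \<eta> v" "v \<notin> F"
  shows "restr (topple G v \<eta>) = (\<lambda>u. restr \<eta> u + (if u \<in> F \<and> v \<in> B then mult G v u else 0))"
proof -
  have "v \<in> B" if "u \<in> F" "mult G v u > 0" for u
    using mult_F[of u v] that assms(2) mult_sym by auto
  then show ?thesis
    using assms F_nonsinks by (fastforce simp: restr_def topple_def fun_eq_iff)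
qed

text \<open>The chips that \<open>F\<close> receives from \<open>B\<close> in the course of the topplings are supplied in advance.\<close>

lemma topples_to_restr:
  assumes "topples_to G \<eta> vs \<tau>"
  shows "topples_to S
    (\<lambda>u. restr \<eta> u + (if u \<in> F then \<Sum>w\<leftarrow>filter (\<lambda>w. w \<in> B) vs. mult G w u else 0))
    (filter (\<lambda>w. w \<in> F) vs) (restr \<tau>)"
  using assms
proof (induction rule: topples_to.induct)
  case (Nil \<eta>)
  show ?case by (simp add: topples_to.Nil cong: if_cong)
next
  case (Cons \<eta> v vs \<tau>)
  let ?c = "\<lambda>u. if u \<in> F then \<Sum>w\<leftarrow>filter (\<lambda>w. w \<in> B) vs. mult G w u else 0"
  show ?case
  proof (cases "v \<in> F")
    case True
    then have "v \<notin> B" using FB by auto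
    moreover have "unstable S (\<lambda>u. restr \<eta> u + ?c u) v"
      by (rule unstable_add) (rule restr_topple_F(1)[OF Cons.hyps(1) True])
    moreover have "topple S v (\<lambda>u. restr \<eta> u + ?c u) = (\<lambda>u. restr (topple G v \<eta>) u + ?c u)"
      using topple_add[OF restr_topple_F(1)[OF Cons.hyps(1) True], of ?c]
        restr_topple_F(2)[OF Cons.hyps(1) True] by simp
    ultimately show ?thesis using Cons.IH True by (simp add: topples_to.Cons cong: if_cong)
  next
    case False
    have "(\<lambda>u. restr (topple G v \<eta>) u + ?c u) = (\<lambda>u. restr \<eta> u +
        (if u \<in> F then \<Sum>w\<leftarrow>filter (\<lambda>w. w \<in> B) (v # vs). mult G w u else 0))"
      unfolding restr_topple_not_F[OF Cons.hyps(1) False] by auto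
    then show ?thesis using Cons.IH False by simp
  qed
qed

lemma stable_restr: "stable G \<tau> \<Longrightarrow> stable S (restr \<tau>)"
  using F_nonsinks by (auto simp: stable_def unstable_def nonsinks_S deg_S restr_def)

lemma sum_list_const_count:
  fixes f :: "'a \<Rightarrow> nat"
  assumes "\<And>b. b \<in> B \<Longrightarrow> count_list vs b = t"
  shows "(\<Sum>w\<leftarrow>filter (\<lambda>w. w \<in> B) vs. f w) = t * (\<Sum>b\<in>B. f b)"
proof -
  \<comment> \<open>Grouping by vertex is proved for arbitrary counts, since a constant count would
    not survive the induction on the list.\<close>
  have "(\<Sum>w\<leftarrow>filter (\<lambda>w. w \<in> B) vs. f w) = (\<Sum>b\<in>B. count_list vs b * f b)"
    using finite_B
  proof (induction vs)
    case (Cons v vs)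
    have "(\<Sum>b\<in>B. count_list (v # vs) b * f b)
        = (\<Sum>b\<in>B. (if v = b then f b else 0) + count_list vs b * f b)"
      by (intro sum.cong) auto
    also have "\<dots> = (if v \<in> B then f v else 0) + (\<Sum>b\<in>B. count_list vs b * f b)"
      using Cons.prems by (simp add: sum.distrib)
    finally show ?case using Cons by simp
  qed simp
  then show ?thesis using assms by (simp add: sum_distrib_left)
qed

text \<open>With equal toppling counts on B, the chips supplied in advance amount to exactly
  \<open>t\<close> copies of \<beta>.\<close>

lemma restr_stabilization:
  assumes "stabilizable G \<eta>" "\<And>b. b \<in> B \<Longrightarrow> odometer G \<eta> b = t"
  shows "stabilizable S (\<lambda>u. restr \<eta> u + t * burning S u)"
    and "restr (stabilization G \<eta>) = stabilization S (\<lambda>u. restr \<eta> u + t * burning S u)"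
proof -
  obtain vs where vs: "stabilizes_via G \<eta> vs (stabilization G \<eta>)"
    using stabilizes_via_stabilization[OF assms(1)] by blast
  have cnt: "count_list vs b = t" if "b \<in> B" for b
    using odometer_eqI[OF vs] assms(2)[OF that] by simp
  have eq: "(if u \<in> F then \<Sum>w\<leftarrow>filter (\<lambda>w. w \<in> B) vs. mult G w u else 0) = t * burning S u" for u
    using sum_list_const_count[OF cnt, of "\<lambda>w. mult G w u"]
    by (simp add: burning_S) (simp add: burning_def nonsinks_S)
  have "stabilizes_via S (\<lambda>u. restr \<eta> u + t * burning S u)
      (filter (\<lambda>w. w \<in> F) vs) (restr (stabilization G \<eta>))"
    using topples_to_restr[of \<eta> vs "stabilization G \<eta>"] vs stable_restr
    by (simp add: stabilizes_via_def eq)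
  then show "stabilizable S (\<lambda>u. restr \<eta> u + t * burning S u)"
    and "restr (stabilization G \<eta>) = stabilization S (\<lambda>u. restr \<eta> u + t * burning S u)"
    by (auto simp: stabilizable_def stabilization_eqI)
qed

text \<open>On S, \<xi> is stabilized first; its recurrent stabilization then absorbs all copies of
  \<beta>, which removes the dependence on \<open>t\<close>.\<close>

lemma restr_stabilization_recurrent:
  assumes "stabilizable G (\<lambda>u. \<xi> u + \<eta> u)" "configuration S \<xi>"
    and "\<And>b. b \<in> B \<Longrightarrow> odometer G (\<lambda>u. \<xi> u + \<eta> u) b = t"
    and "recurrent S (stabilization S \<xi>)"
  shows "restr (stabilization G (\<lambda>u. \<xi> u + \<eta> u))
    = stabilization S (\<lambda>u. stabilization S \<xi> u + restr \<eta> u)"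
proof -
  have "restr (\<lambda>u. \<xi> u + \<eta> u) = (\<lambda>u. \<xi> u + restr \<eta> u)"
    using assms(2) by (auto simp: restr_def configuration_def nonsinks_S fun_eq_iff)
  with restr_stabilization[OF assms(1,3)]
  have st: "stabilizable S (\<lambda>u. \<xi> u + (restr \<eta> u + t * burning S u))"
    and eq: "restr (stabilization G (\<lambda>u. \<xi> u + \<eta> u))
      = stabilization S (\<lambda>u. \<xi> u + (restr \<eta> u + t * burning S u))"
    by (auto simp: add.assoc)
  obtain vs where "topples_to S (\<lambda>u. stabilization S \<xi> u + t * burning S u) vs (stabilization S \<xi>)"
    using wf_sink_graph.topples_to_burning_multiple[OF wf_S _ assms(4)] finite_F nonsinks_S
    by metis
  from topples_to_add[OF this, of "restr \<eta>"]
  have "topples_to S (\<lambda>u. stabilization S \<xi> u + (restr \<eta> u + t * burning S u)) vs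
      (\<lambda>u. stabilization S \<xi> u + restr \<eta> u)"
    by (simp add: ac_simps)
  from stabilization_topples_to(2)[OF this stabilization_add(1)[OF st]]
  show ?thesis using stabilization_add(2)[OF st] eq by simp
qed

text \<open>Recurrence of \<sigma> makes some configuration above \<eta> stabilizable, and
  \<open>stabilizable_mono\<close> descends to \<eta>.\<close>

lemma stabilizable_S:
  assumes "recurrent S \<sigma>" "configuration S \<eta>"
  shows "stabilizable S \<eta>"
  using assms stabilizable_mono unfolding recurrent_def by blast

end

section \<open>Periodicity of the stabilizations on F\<close>

theorem corollary13:
  fixes G S :: "'a sink_graph"
    and B F H :: "'a set"
    and \<eta>\<^sub>F \<eta>\<^sub>G :: "'a \<Rightarrow> nat"
    and N :: nat
  assumes "wf_sink_graph G"
    and "connected_graph G"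
    and "finite B"
    and "B \<subseteq> nonsinks G"
    and "disconnects_into G B F H"
    and "finite F"
    and "F \<inter> sinks G = {}"
    and S: "S = with_sink_boundary G F B"
    and "configuration S \<eta>\<^sub>F"
    and "configuration G \<eta>\<^sub>G"
    and N: "\<And>k. k \<ge> N \<Longrightarrow> recurrent S (stabilization S (\<lambda>v. k * \<eta>\<^sub>F v))"
    and "\<And>k. k \<ge> N \<Longrightarrow> stabilizable G (\<lambda>v. k * \<eta>\<^sub>F v + \<eta>\<^sub>G v)"
    and "\<And>k. k \<ge> N \<Longrightarrow>
           \<exists>t. \<forall>b\<in>B. odometer G (\<lambda>v. k * \<eta>\<^sub>F v + \<eta>\<^sub>G v) b = t"
  shows "\<forall>v\<in>F. eventually_periodic (\<lambda>k. stabilization G (\<lambda>u. k * \<eta>\<^sub>F u + \<eta>\<^sub>G u) v)"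
proof -
  interpret separated_part G B F H
    using assms by (simp add: separated_part_def separated_part_axioms_def)
  have fin: "finite (nonsinks S)" using finite_F nonsinks_S S by simp
  define r where "r k = stabilization S (\<lambda>v. k * \<eta>\<^sub>F v)" for k
  define f where "f k = stabilization G (\<lambda>u. k * \<eta>\<^sub>F u + \<eta>\<^sub>G u)" for k
  have conf: "configuration S (\<lambda>v. k * \<eta>\<^sub>F v)" for k
    using \<open>configuration S \<eta>\<^sub>F\<close> by (simp add: configuration_def)
  have rec: "recurrent S (r k)" if "k \<ge> N" for k
    using N that by (simp add: r_def)
  have f: "restr (f k) = stabilization S (\<lambda>u. r k u + restr \<eta>\<^sub>G u)" if k: "k \<ge> N" for k
  proof -
    obtain t where "\<And>b. b \<in> B \<Longrightarrow> odometer G (\<lambda>v. k * \<eta>\<^sub>F v + \<eta>\<^sub>G v) b = t"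
      using assms(13)[OF k] by blast
    from restr_stabilization_recurrent[OF assms(12)[OF k] _ this] conf N[OF k]
    show ?thesis by (simp add: f_def r_def S)
  qed
  have step: "r (Suc k) = stabilization S (\<lambda>v. r k v + \<eta>\<^sub>F v)" for k
  proof -
    have "(\<lambda>v. Suc k * \<eta>\<^sub>F v) = (\<lambda>v. k * \<eta>\<^sub>F v + \<eta>\<^sub>F v)" by auto
    \<comment> \<open>Recurrence at the single index \<open>N\<close> makes every configuration on S
      stabilizable, so the recursion holds for all \<open>k\<close>.\<close>
    moreover have "stabilizable S (\<lambda>v. Suc k * \<eta>\<^sub>F v)"
      using stabilizable_S[OF N[unfolded S, OF order.refl] conf[unfolded S]] unfolding S .
    ultimately show ?thesis
      using stabilization_add(2)[of S "\<lambda>v. k * \<eta>\<^sub>F v" \<eta>\<^sub>F] by (simp add: r_def)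
  qed
  have "r k \<in> {\<sigma>. configuration S \<sigma> \<and> stable S \<sigma>}" if "k \<ge> N" for k
    using rec[OF that] by (simp add: recurrent_def)
  from eventually_periodic_finite_orbit[where r = r and N = N
        and g = "\<lambda>\<sigma>. stabilization S (\<lambda>v. \<sigma> v + \<eta>\<^sub>F v)",
      OF finite_stable_configurations[OF fin] this step]
  obtain p k\<^sub>0 where p: "p > 0" "k\<^sub>0 \<ge> N" "\<And>k. k \<ge> k\<^sub>0 \<Longrightarrow> r (k + p) = r k"
    by auto
  show ?thesis
  proof
    fix v assume v: "v \<in> F"
    have "f (k + p) v = f k v" if "k \<ge> k\<^sub>0" for k
    proof -
      \<comment> \<open>On F, \<open>f k\<close> depends on \<open>k\<close> only through
        \<open>r k\<close>; both \<open>k\<close> and \<open>k + p\<close> are at least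
        \<open>N\<close>, so the formula \<open>f\<close> applies to each.\<close>
      have "restr (f (k + p)) = restr (f k)"
        using f[of k] f[of "k + p"] p that by simp
      then show ?thesis using v by (metis restr_def)
    qed
    then show "eventually_periodic (\<lambda>k. stabilization G (\<lambda>u. k * \<eta>\<^sub>F u + \<eta>\<^sub>G u) v)"
      using p(1) unfolding eventually_periodic_def f_def by blast
  qed
qed

end
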